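(* For every integer $n\geqslant 3$ and every integer $k\geqslant 0$, the sub-Eulerian numbers of type $D$ satisfy: (i) $D_{n,k}^1=(2k-1)D_{n-1,k}^1+2(n-k)D_{n-1,k-1}^1+D_{n-1,k}^{0,1}+D_{n-1,k-1}^{\geqslant 2}+D_{n-1,k}^{0,\geqslant 2}$; (ii) $D_{n,k}^{0,1}=2(k-1)D_{n-1,k}^{0,1}+(2n-2k+1)D_{n-1,k-1}^{0,1}+D_{n-1,k-1}^1+D_{n-1,k-2}^{\geqslant 2}+D_{n-1,k-1}^{0,\geqslant 2}$; (iii) $D_{n,k}^{\geqslant 2}=(2k+1)D_{n-1,k}^{\geqslant 2}+2(n-k-1)D_{n-1,k-1}^{\geqslant 2}+D_{n-1,k}^1+D_{n-1,k+1}^{0,1}+D_{n-1,k}^{0,\geqslant 2}$; (iv) $D_{n,k}^{0,\geqslant 2}=2kD_{n-1,k}^{0,\geqslant 2}+(2n-2k-1)D_{n-1,k-1}^{0,\geqslant 2}+D_{n-1,k-1}^1+D_{n-1,k}^{0,1}+D_{n-1,k-1}^{\geqslant 2}$.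
   Context: $B_n$ is the group of signed permutations $\pi=\pi_1\pi_2\cdots\pi_n$ of $\{1,\dots,n\}$, and $D_n\subset B_n$ is the subgroup (Coxeter group of type $D$) of those with an even number of negative entries. For $n\geqslant 2$, an index $i\in\{0,1,\dots,n-1\}$ is a ($D$-)descent of $\pi$ if $\pi_i>\pi_{i+1}$, where $\pi_0:=-\pi_2$. For $n\geqslant 2$ and an integer $k$, the sub-Eulerian numbers $D_{n,k}^1$, $D_{n,k}^{0,1}$, $D_{n,k}^{\geqslant 2}$, $D_{n,k}^{0,\geqslant 2}$ are the numbers of elements of $D_n$ with exactly $k$ descents such that, respectively: $1$ is a descent but $0$ is not; both $0$ and $1$ are descents; neither $0$ nor $1$ is a descent; $0$ is a descent but $1$ is not. (In particular they vanish for $k<0$.) *)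

theory Defs
  imports "HOL-Combinatorics.Permutations"
begin

text \<open>A signed permutation of \<open>{1..n}\<close> is an odd bijection of \<open>{-n..n}\<close>. Oddness forces
  \<open>\<pi> 0 = 0\<close>, and \<^term>\<open>(permutes)\<close> makes \<open>\<pi>\<close> the identity outside \<open>{-n..n}\<close>, so that
  \<open>\<pi>\<close> corresponds to its one-line notation \<open>\<pi> 1, \<dots>, \<pi> n\<close>.\<close>

definition signed_perms :: "nat \<Rightarrow> (int \<Rightarrow> int) set" where
  "signed_perms n = {\<pi>. \<pi> permutes {- int n..int n} \<and> (\<forall>i. \<pi> (- i) = - \<pi> i)}"

definition even_signed_perms :: "nat \<Rightarrow> (int \<Rightarrow> int) set" where
  "even_signed_perms n = {\<pi> \<in> signed_perms n. even (card {i \<in> {1..int n}. \<pi> i < 0})}"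

text \<open>For descents of type D the value at index \<open>0\<close> is by convention \<open>- \<pi> 2\<close>, which is not
  the value \<open>\<pi> 0 = 0\<close> of the map \<open>\<pi>\<close>.\<close>

definition D_entry :: "(int \<Rightarrow> int) \<Rightarrow> int \<Rightarrow> int" where
  "D_entry \<pi> i = (if i = 0 then - \<pi> 2 else \<pi> i)"

definition D_descents :: "nat \<Rightarrow> (int \<Rightarrow> int) \<Rightarrow> int set" where
  "D_descents n \<pi> = {i \<in> {0..int n - 1}. D_entry \<pi> i > D_entry \<pi> (i + 1)}"

text \<open>The sub-Eulerian numbers of type D, meaningful for \<open>n \<ge> 2\<close>. They are taken in
  \<^typ>\<open>int\<close> and indexed by an integer \<open>k\<close> since the recurrences have negative coefficients
  and refer to \<open>k - 1\<close> and \<open>k - 2\<close>; they vanish for \<open>k < 0\<close>.\<close>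

definition D1 :: "nat \<Rightarrow> int \<Rightarrow> int" where
  "D1 n k = int (card {\<pi> \<in> even_signed_perms n. int (card (D_descents n \<pi>)) = k
     \<and> 0 \<notin> D_descents n \<pi> \<and> 1 \<in> D_descents n \<pi>})"

definition D01 :: "nat \<Rightarrow> int \<Rightarrow> int" where
  "D01 n k = int (card {\<pi> \<in> even_signed_perms n. int (card (D_descents n \<pi>)) = k
     \<and> 0 \<in> D_descents n \<pi> \<and> 1 \<in> D_descents n \<pi>})"

definition Dge2 :: "nat \<Rightarrow> int \<Rightarrow> int" where
  "Dge2 n k = int (card {\<pi> \<in> even_signed_perms n. int (card (D_descents n \<pi>)) = k
     \<and> 0 \<notin> D_descents n \<pi> \<and> 1 \<notin> D_descents n \<pi>})"

definition D0ge2 :: "nat \<Rightarrow> int \<Rightarrow> int" where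
  "D0ge2 n k = int (card {\<pi> \<in> even_signed_perms n. int (card (D_descents n \<pi>)) = k
     \<and> 0 \<in> D_descents n \<pi> \<and> 1 \<notin> D_descents n \<pi>})"

end

theory Submission
  imports Defs
begin

text \<open>
  The recurrences come from removing the letter of largest absolute value from the one-line
  notation of a signed permutation. Removing \<open>- n\<close> changes the parity of the number of negative
  entries, so this does not map \<open>D\<^sub>n\<close> to \<open>D\<^sub>n\<^sub>-\<^sub>1\<close>. The first step is therefore to pass to the whole
  group \<open>B\<^sub>n\<close>: exchanging the values \<open>1\<close> and \<open>-1\<close> changes the parity, but it keeps every
  comparison between entries of distinct absolute values, and thereby every type D descent
  (\<open>D_descents_flip_one\<close>). Each sub-Eulerian number is thus half of the same count over \<open>B\<^sub>n\<close>
  (\<open>double_sub_Eulerian\<close>).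

  In \<open>B\<^sub>n\<close> every word arises exactly once by inserting \<open>n\<close> or \<open>- n\<close> at one of \<open>n\<close> places of a word
  \<open>x y \<dots>\<close> of \<open>B\<^sub>n\<^sub>-\<^sub>1\<close> (\<open>sum_words_Suc\<close>). Let \<open>a\<close> and \<open>b\<close> say whether that word has descents at \<open>0\<close>
  and \<open>1\<close>, that is \<open>x + y < 0\<close> and \<open>x > y\<close>, and let \<open>d\<close> count its other descents.
  \<^item> To the right of \<open>y\<close>, an insertion leaves \<open>a\<close> and \<open>b\<close> alone. Between two letters, both signs
    keep \<open>d\<close> if there was a descent there, and both raise it by one otherwise; at the end,
    \<open>n\<close> keeps \<open>d\<close> and \<open>- n\<close> raises it. So \<open>2 d + 1\<close> insertions keep \<open>d\<close>, and the other
    \<open>2 (n - 3 - d) + 1\<close> raise it by one (\<open>sum_des_ins\<close>).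
  \<^item> Between \<open>x\<close> and \<open>y\<close>, inserting \<open>n\<close> gives no descent at \<open>0\<close> or \<open>1\<close> and \<open>d + 1\<close> others, and
    inserting \<open>- n\<close> gives both descents and \<open>d\<close> others.
  \<^item> In front, \<open>n\<close> gives only the descent at \<open>1\<close> and \<open>- n\<close> only the one at \<open>0\<close>. The comparison of
    \<open>x\<close> with \<open>y\<close> moves to position \<open>2\<close>, so that the number of other descents becomes
    \<open>d\<close>, or \<open>d + 1\<close> if \<open>b\<close> holds.

  This is one identity for an arbitrary weight depending on \<open>(a, b, d)\<close> (\<open>weighted_count_Suc\<close>).
  The four recurrences are its instances for the indicator functions of the four classes.
\<close>

section \<open>Signed permutations as words\<close>

definition words :: "nat \<Rightarrow> int list set" where
  "words n = {xs. distinct (map abs xs) \<and> abs ` set xs = {1..int n}}"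

lemma words_length: "xs \<in> words n \<Longrightarrow> length xs = n"
  unfolding words_def using distinct_card[of "map abs xs"] by simp

lemma words_abs_le: "xs \<in> words n \<Longrightarrow> x \<in> set xs \<Longrightarrow> \<bar>x\<bar> \<le> int n"
  unfolding words_def by (metis (mono_tags, lifting) atLeastAtMost_iff imageI mem_Collect_eq)

lemma finite_words: "finite (words n)"
proof -
  have "words n \<subseteq> {xs. set xs \<subseteq> {- int n..int n} \<and> length xs = n}"
    using words_length words_abs_le by (fastforce simp: abs_le_iff)
  then show ?thesis
    using finite_lists_length_eq finite_subset by blast
qed

text \<open>The inverse of taking the one-line notation. The factor \<open>sgn i\<close> makes the map odd and sends
  \<open>0\<close> to \<open>0\<close>, whatever letter the truncated index \<open>0 - 1\<close> selects.\<close>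

definition odd_extension :: "int list \<Rightarrow> int \<Rightarrow> int" where
  "odd_extension xs i =
     (if \<bar>i\<bar> \<le> int (length xs) then sgn i * xs ! (nat \<bar>i\<bar> - 1) else i)"

lemma odd_extension_signed_perm:
  assumes xs: "xs \<in> words n"
  shows "odd_extension xs \<in> signed_perms n"
proof -
  let ?f = "odd_extension xs" and ?S = "{- int n..int n}"
  have len: "length xs = n" using xs by (rule words_length)
  have "y \<in> ?f ` ?S" if y: "y \<in> ?S" for y
  proof (cases "y = 0")
    case True
    have "?f 0 = 0" by (simp add: odd_extension_def)
    then show ?thesis using True by force
  next
    case False
    then have "\<bar>y\<bar> \<in> abs ` set xs" using y xs by (auto simp: words_def)
    then obtain j where j: "j < n" "\<bar>xs ! j\<bar> = \<bar>y\<bar>"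
      using len by (auto simp: in_set_conv_nth)
    then consider "y = xs ! j" | "y = - xs ! j" by linarith
    then show ?thesis
    proof cases
      case 1
      then have "?f (int j + 1) = y" using j len by (simp add: odd_extension_def nat_add_distrib)
      then show ?thesis using j by force
    next
      case 2
      have "\<bar>- int j - 1\<bar> = int j + 1" by simp
      then have "?f (- int j - 1) = y"
        using j len 2 by (simp add: odd_extension_def nat_add_distrib)
      then show ?thesis using j by force
    qed
  qed
  then have "?S \<subseteq> ?f ` ?S" by blast
  then have im: "?f ` ?S = ?S"
    by (metis card_image_le card_seteq finite_atLeastAtMost_int finite_imageI)
  then have "inj_on ?f ?S" by (simp add: eq_card_imp_inj_on)
  then have "?f permutes ?S"
    using im len by (intro bij_imp_permutes) (auto simp: bij_betw_def odd_extension_def)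
  moreover have "?f (- i) = - ?f i" for i by (simp add: odd_extension_def)
  ultimately show ?thesis by (simp add: signed_perms_def)
qed

lemma map_odd_extension: "map (odd_extension xs) [1..int (length xs)] = xs"
  by (rule nth_equalityI) (auto simp: odd_extension_def nat_add_distrib sgn_if)

lemma signed_perm_minus: "\<pi> \<in> signed_perms n \<Longrightarrow> \<pi> (- i) = - \<pi> i"
  by (simp add: signed_perms_def)

lemma signed_perm_zero: "\<pi> \<in> signed_perms n \<Longrightarrow> \<pi> 0 = 0"
  using signed_perm_minus[of \<pi> n 0] by simp

text \<open>A signed permutation is injective on absolute values as well, since
  \<open>\<bar>\<pi> i\<bar> = \<bar>\<pi> j\<bar>\<close> means that \<open>\<pi> i\<close> is \<open>\<pi> j\<close> or \<open>\<pi> (- j)\<close>.\<close>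

lemma signed_perm_abs_eq:
  assumes "\<pi> \<in> signed_perms n" "\<bar>\<pi> i\<bar> = \<bar>\<pi> j\<bar>"
  shows "\<bar>i\<bar> = \<bar>j\<bar>"
proof -
  have "inj \<pi>" and odd: "\<pi> (- j) = - \<pi> j"
    using assms(1) by (auto simp: signed_perms_def permutes_inj)
  have "\<pi> i = \<pi> j \<or> \<pi> i = \<pi> (- j)" using assms(2) odd by linarith
  then have "i = j \<or> i = - j" using \<open>inj \<pi>\<close> by (simp add: inj_eq)
  then show ?thesis by auto
qed

lemma map_signed_perm_words:
  assumes p: "\<pi> \<in> signed_perms n"
  shows "map \<pi> [1..int n] \<in> words n"
proof -
  have perm: "\<pi> permutes {- int n..int n}"
    using p by (simp add: signed_perms_def)
  have inj: "inj_on (\<lambda>i. \<bar>\<pi> i\<bar>) {1..int n}"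
    by (intro inj_onI) (drule signed_perm_abs_eq[OF p], simp)
  have "\<pi> 0 = 0" using p by (rule signed_perm_zero)
  have "\<bar>\<pi> i\<bar> \<in> {1..int n}" if "i \<in> {1..int n}" for i
  proof -
    have "\<pi> i \<in> {- int n..int n}" using permutes_in_image[OF perm] that by auto
    moreover have "\<pi> i \<noteq> 0" using signed_perm_abs_eq[OF p, of i 0] \<open>\<pi> 0 = 0\<close> that by auto
    ultimately show ?thesis by auto
  qed
  then have "(\<lambda>i. \<bar>\<pi> i\<bar>) ` {1..int n} = {1..int n}"
    using inj by (intro endo_inj_surj) auto
  then show ?thesis
    using inj by (auto simp: words_def comp_def image_image intro!: distinct_map[THEN iffD2])
qed

text \<open>Oddness and the identity outside \<open>{- n..n}\<close> recover a signed permutation from its values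
  on \<open>{1..n}\<close>.\<close>

lemma bij_betw_signed_perms_words:
  "bij_betw (\<lambda>\<pi>. map \<pi> [1..int n]) (signed_perms n) (words n)"
proof (rule bij_betwI')
  fix \<pi> \<rho> assume p: "\<pi> \<in> signed_perms n" and r: "\<rho> \<in> signed_perms n"
  show "(map \<pi> [1..int n] = map \<rho> [1..int n]) = (\<pi> = \<rho>)"
  proof
    assume "map \<pi> [1..int n] = map \<rho> [1..int n]"
    then have pos: "\<pi> i = \<rho> i" if "1 \<le> i" "i \<le> int n" for i using that by simp
    show "\<pi> = \<rho>"
    proof
      fix i
      have odd: "\<pi> (- i) = - \<pi> i" "\<rho> (- i) = - \<rho> i" "\<pi> 0 = 0" "\<rho> 0 = 0"
        using p r by (simp_all add: signed_perm_minus signed_perm_zero)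
      consider "\<bar>i\<bar> > int n" | "i = 0" | "1 \<le> i" "i \<le> int n" | "1 \<le> - i" "- i \<le> int n" by linarith
      then show "\<pi> i = \<rho> i"
      proof cases
        case 1
        then have "i \<notin> {- int n..int n}" by auto
        then show ?thesis using p r unfolding signed_perms_def
          by (metis (mono_tags, lifting) mem_Collect_eq permutes_not_in)
      qed (use odd pos[of i] pos[of "- i"] in auto)
    qed
  qed simp
next
  fix xs assume xs: "xs \<in> words n"
  then show "\<exists>\<pi>\<in>signed_perms n. xs = map \<pi> [1..int n]"
    using odd_extension_signed_perm[OF xs] map_odd_extension[of xs] words_length[OF xs] by metis
qed (rule map_signed_perm_words)

lemma finite_signed_perms: "finite (signed_perms n)"
  using bij_betw_finite[OF bij_betw_signed_perms_words] finite_words by blast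

section \<open>Descents in terms of words\<close>

fun des :: "int list \<Rightarrow> int" where
  "des (x # y # zs) = of_bool (x > y) + des (y # zs)"
| "des _ = 0"

lemma des_map_upto: "des (map f [a..b]) = int (card {i \<in> {a..b - 1}. f i > f (i + 1)})"
proof (induction a b rule: upto.induct)
  case (1 a b)
  show ?case
  proof (cases "a < b")
    case False
    then have "{a..b - 1} = {}" by simp
    moreover have "[a..b] = [] \<or> [a..b] = [a]" using False by (cases "a = b") auto
    ultimately show ?thesis by auto
  next
    case True
    have "[a..b] = a # (a + 1) # [2 + a..b]"
      using True upto_rec1[of a b] upto_rec1[of "a + 1" b] by simp
    then have "des (map f [a..b]) =
        of_bool (f a > f (a + 1)) + int (card {i \<in> {a + 1..b - 1}. f i > f (i + 1)})"
      using 1 True upto_rec1[of "a + 1" b] by simp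
    moreover have "{i \<in> {a..b - 1}. f i > f (i + 1)}
        = (if f a > f (a + 1) then {a} else {}) \<union> {i \<in> {a + 1..b - 1}. f i > f (i + 1)}"
      using True by (auto simp: order_le_less)
    moreover have "card (\<dots>) = card (if f a > f (a + 1) then {a} else {}) +
        card {i \<in> {a + 1..b - 1}. f i > f (i + 1)}"
      by (rule card_Un_disjoint) (auto intro: finite_subset[of _ "{a + 1..b - 1}"])
    ultimately show ?thesis by simp
  qed
qed

text \<open>The weight of a word may depend only on whether it has type D descents at \<open>0\<close> and at \<open>1\<close>
  and on the number of its other descents. The latter are the descents of the word without its
  first letter. Keeping the weight arbitrary lets one recurrence serve all four classes.\<close>

fun stat :: "(bool \<Rightarrow> bool \<Rightarrow> int \<Rightarrow> int) \<Rightarrow> int list \<Rightarrow> int" where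
  "stat G (x # y # zs) = G (x + y < 0) (x > y) (des (y # zs))"
| "stat G _ = 0"

definition weighted_count :: "(bool \<Rightarrow> bool \<Rightarrow> int \<Rightarrow> int) \<Rightarrow> nat \<Rightarrow> int" where
  "weighted_count G n = (\<Sum>w\<in>words n. stat G w)"

lemma stat_map_signed_perm:
  assumes "n \<ge> 2"
  shows "stat G (map \<pi> [1..int n]) =
    G (0 \<in> D_descents n \<pi>) (1 \<in> D_descents n \<pi>)
      (int (card (D_descents n \<pi>)) - of_bool (0 \<in> D_descents n \<pi>) - of_bool (1 \<in> D_descents n \<pi>))"
proof -
  let ?D = "D_descents n \<pi>" and ?T = "{i \<in> {2..int n - 1}. \<pi> i > \<pi> (i + 1)}"
  have zero: "0 \<in> ?D \<longleftrightarrow> \<pi> 1 + \<pi> 2 < 0" and one: "1 \<in> ?D \<longleftrightarrow> \<pi> 1 > \<pi> 2"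
    using assms by (auto simp: D_descents_def D_entry_def)
  have "?D = (?D \<inter> {0}) \<union> (?D \<inter> {1}) \<union> ?T"
    by (auto simp: D_descents_def D_entry_def)
  then have "card ?D = card ((?D \<inter> {0}) \<union> (?D \<inter> {1}) \<union> ?T)" by simp
  also have "\<dots> = card (?D \<inter> {0}) + card (?D \<inter> {1}) + card ?T"
    by (subst card_Un_disjoint; (subst card_Un_disjoint)?)
      (auto intro: finite_subset[of _ "{2..int n - 1}"])
  finally have "int (card ?D) = of_bool (0 \<in> ?D) + of_bool (1 \<in> ?D) + int (card ?T)"
    by (cases "0 \<in> ?D"; cases "1 \<in> ?D") simp_all
  moreover have "[1..int n] = 1 # [2..int n]" "[2..int n] = 2 # [3..int n]"
    using assms upto_rec1[of 1 "int n"] upto_rec1[of 2 "int n"] by simp_all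
  ultimately show ?thesis using des_map_upto[of \<pi> 2 "int n"] zero one by simp
qed

section \<open>Changing the sign of the value one\<close>

definition flip_one :: "(int \<Rightarrow> int) \<Rightarrow> int \<Rightarrow> int" where
  "flip_one \<pi> i = (if \<bar>\<pi> i\<bar> = 1 then - \<pi> i else \<pi> i)"

lemma flip_one_flip_one [simp]: "flip_one (flip_one \<pi>) = \<pi>"
  by (auto simp: flip_one_def)

lemma flip_one_signed_perm:
  assumes p: "\<pi> \<in> signed_perms n" and n: "n \<ge> 1"
  shows "flip_one \<pi> \<in> signed_perms n"
proof -
  have "transpose 1 (- 1) permutes {- int n..int n}"
    using n by (intro permutes_swap_id) auto
  moreover have "\<pi> permutes {- int n..int n}" using p by (simp add: signed_perms_def)
  moreover have "flip_one \<pi> = transpose 1 (- 1) \<circ> \<pi>"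
    by (auto simp: flip_one_def transpose_def fun_eq_iff)
  ultimately have "flip_one \<pi> permutes {- int n..int n}"
    by (simp add: permutes_compose)
  moreover have "flip_one \<pi> (- i) = - flip_one \<pi> i" for i
    using p by (simp add: signed_perms_def flip_one_def)
  ultimately show ?thesis by (simp add: signed_perms_def)
qed

text \<open>No integer other than \<open>0\<close> lies strictly between \<open>-1\<close> and \<open>1\<close>, so turning \<open>1\<close> into \<open>-1\<close> or
  conversely keeps the order of two nonzero integers with distinct absolute values. All entries
  compared in a descent are of this kind: at \<open>0\<close> they are \<open>- \<pi> 2\<close> and \<open>\<pi> 1\<close>.\<close>

lemma D_descents_flip_one:
  assumes p: "\<pi> \<in> signed_perms n"
  shows "D_descents n (flip_one \<pi>) = D_descents n \<pi>"
proof -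
  have "D_entry (flip_one \<pi>) i > D_entry (flip_one \<pi>) (i + 1) \<longleftrightarrow>
        D_entry \<pi> i > D_entry \<pi> (i + 1)" if "i \<ge> 0" for i
  proof -
    have "\<bar>\<pi> 2\<bar> \<noteq> \<bar>\<pi> 1\<bar>" "\<bar>\<pi> i\<bar> \<noteq> \<bar>\<pi> (i + 1)\<bar>"
      using signed_perm_abs_eq[OF p, of 2 1] signed_perm_abs_eq[OF p, of i "i + 1"] that by auto
    moreover have "\<pi> j \<noteq> 0" if "j > 0" for j
      using signed_perm_abs_eq[OF p, of j 0] signed_perm_zero[OF p] that by auto
    note this[of 1] this[of 2] this[of i] this[of "i + 1"]
    ultimately show ?thesis using that
      by (cases "i = 0") (auto simp: D_entry_def flip_one_def)
  qed
  then show ?thesis by (auto simp: D_descents_def)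
qed

text \<open>Exactly one position in \<open>{1..n}\<close> carries the value \<open>1\<close> or \<open>-1\<close>, and only its sign changes.\<close>

lemma even_signed_perms_flip_one:
  assumes p: "\<pi> \<in> signed_perms n" and n: "n \<ge> 1"
  shows "flip_one \<pi> \<in> even_signed_perms n \<longleftrightarrow> \<pi> \<notin> even_signed_perms n"
proof -
  let ?N = "\<lambda>\<pi>. {i \<in> {1..int n}. \<pi> i < 0}"
  have "1 \<in> abs ` set (map \<pi> [1..int n])"
    using map_signed_perm_words[OF p] n by (simp add: words_def del: set_map)
  then obtain i where i: "i \<in> {1..int n}" "\<bar>\<pi> i\<bar> = 1" by auto
  then have "\<bar>\<pi> j\<bar> \<noteq> 1" if "j \<in> {1..int n}" "j \<noteq> i" for j
    using signed_perm_abs_eq[OF p, of i j] that by auto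
  then have sign: "flip_one \<pi> j < 0 \<longleftrightarrow> (if j = i then \<not> \<pi> i < 0 else \<pi> j < 0)"
    if "j \<in> {1..int n}" for j
    using i that by (auto simp: flip_one_def)
  have fin: "finite (?N \<rho>)" for \<rho> :: "int \<Rightarrow> int"
    by (rule finite_subset[of _ "{1..int n}"]) auto
  have "even (card (?N (flip_one \<pi>))) \<longleftrightarrow> odd (card (?N \<pi>))"
  proof (cases "\<pi> i < 0")
    case True
    then have "?N \<pi> = insert i (?N (flip_one \<pi>))" "i \<notin> ?N (flip_one \<pi>)"
      using i sign by (auto split: if_splits)
    then show ?thesis using fin by simp
  next
    case False
    then have "?N (flip_one \<pi>) = insert i (?N \<pi>)" "i \<notin> ?N \<pi>"
      using i sign by (auto split: if_splits)
    then show ?thesis using fin by simp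
  qed
  then show ?thesis
    using p flip_one_signed_perm[OF p n] by (simp add: even_signed_perms_def)
qed

lemma card_even_signed_perms_double:
  assumes n: "n \<ge> 1"
  shows "2 * card {\<pi> \<in> even_signed_perms n. P (D_descents n \<pi>)}
    = card {\<pi> \<in> signed_perms n. P (D_descents n \<pi>)}"
proof -
  let ?E = "{\<pi> \<in> even_signed_perms n. P (D_descents n \<pi>)}"
  let ?O = "{\<pi> \<in> signed_perms n - even_signed_perms n. P (D_descents n \<pi>)}"
  have sub: "even_signed_perms n \<subseteq> signed_perms n" by (auto simp: even_signed_perms_def)
  have "bij_betw flip_one ?E ?O"
    using sub flip_one_signed_perm[OF _ n] even_signed_perms_flip_one[OF _ n]
    by (intro bij_betw_byWitness[where f' = flip_one])
      (auto simp: D_descents_flip_one subset_iff)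
  then have "card ?O = card ?E" by (simp add: bij_betw_same_card)
  moreover have "{\<pi> \<in> signed_perms n. P (D_descents n \<pi>)} = ?E \<union> ?O" using sub by auto
  moreover have "finite ?E" "finite ?O" "?E \<inter> ?O = {}"
    using finite_signed_perms sub by (auto intro: finite_subset)
  ultimately show ?thesis by (simp add: card_Un_disjoint)
qed

definition in_class :: "bool \<Rightarrow> bool \<Rightarrow> int \<Rightarrow> bool \<Rightarrow> bool \<Rightarrow> int \<Rightarrow> int" where
  "in_class a0 b0 k a b d = of_bool (a = a0 \<and> b = b0 \<and> d + of_bool a + of_bool b = k)"

lemma double_sub_Eulerian:
  assumes n: "n \<ge> 2"
  shows "2 * int (card {\<pi> \<in> even_signed_perms n. int (card (D_descents n \<pi>)) = k
       \<and> (0 \<in> D_descents n \<pi>) = a0 \<and> (1 \<in> D_descents n \<pi>) = b0})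
    = weighted_count (in_class a0 b0 k) n"
    (is "_ = weighted_count ?G n")
proof -
  let ?P = "\<lambda>D. int (card D) = k \<and> (0 \<in> D) = a0 \<and> (1 \<in> D) = b0"
  have "weighted_count ?G n = (\<Sum>\<pi>\<in>signed_perms n. stat ?G (map \<pi> [1..int n]))"
    unfolding weighted_count_def
    by (rule sum.reindex_bij_betw[OF bij_betw_signed_perms_words, symmetric])
  also have "\<dots> = (\<Sum>\<pi>\<in>signed_perms n. of_bool (?P (D_descents n \<pi>)))"
    unfolding stat_map_signed_perm[OF n] in_class_def by (intro sum.cong refl) auto
  also have "\<dots> = int (card {\<pi> \<in> signed_perms n. ?P (D_descents n \<pi>)})"
    using finite_signed_perms by (simp add: Int_def)
  also have "\<dots> = 2 * int (card {\<pi> \<in> even_signed_perms n. ?P (D_descents n \<pi>)})"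
    using card_even_signed_perms_double[of n ?P] n by simp
  finally show ?thesis by simp
qed

section \<open>Inserting the entry of largest absolute value\<close>

definition ins :: "nat \<Rightarrow> int \<Rightarrow> int list \<Rightarrow> int list" where
  "ins j e v = take j v @ e # drop j v"

lemma ins_simps [simp]: "ins 0 e v = e # v" "ins (Suc j) e (x # v) = x # ins j e v"
  by (simp_all add: ins_def)

text \<open>The letter of absolute value \<open>m + 1\<close> occurs exactly once in a word of length \<open>m + 1\<close>. Removing
  it recovers the shorter word, and its position and sign recover the insertion.\<close>

lemma sum_words_Suc:
  "(\<Sum>w\<in>words (Suc m). F w) =
   (\<Sum>v\<in>words m. \<Sum>j\<le>m. F (ins j (int m + 1) v) + F (ins j (- int m - 1) v) :: int)"
proof -
  let ?N = "int m + 1"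
  let ?E = "{?N, - ?N}"
  let ?A = "words m \<times> {..m} \<times> ?E"
  let ?f = "\<lambda>(v, j, e). ins j e v"
  let ?Q = "\<lambda>x. \<bar>x\<bar> \<noteq> ?N"
  let ?g = "\<lambda>w. let j = length (takeWhile ?Q w) in (filter ?Q w, j, w ! j)"
  have small: "\<forall>x\<in>set v. ?Q x" if "v \<in> words m" for v
    using words_abs_le[OF that] by fastforce
  have split: "\<exists>us e vs. w = us @ e # vs \<and> \<bar>e\<bar> = ?N \<and> (\<forall>x\<in>set us. ?Q x) \<and> (\<forall>x\<in>set vs. ?Q x)"
    if w: "w \<in> words (Suc m)" for w
  proof -
    have "?N \<in> abs ` set w" using w by (auto simp: words_def)
    then obtain e where "e \<in> set w" and e: "\<bar>e\<bar> = ?N" by auto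
    then obtain us vs where w_eq: "w = us @ e # vs" by (auto dest: split_list)
    then have "?N \<notin> abs ` set us" "?N \<notin> abs ` set vs" using w e by (auto simp: words_def)
    then have "(\<forall>x\<in>set us. ?Q x) \<and> (\<forall>x\<in>set vs. ?Q x)" by (metis imageI)
    then show ?thesis using w_eq e by blast
  qed
  have "bij_betw ?f ?A (words (Suc m))"
  proof (rule bij_betw_byWitness[where f' = ?g])
    show "\<forall>p\<in>?A. ?g (?f p) = p"
    proof
      fix p assume "p \<in> ?A"
      then obtain v j e where p: "p = (v, j, e)" and v: "v \<in> words m" and j: "j \<in> {..m}"
        and e: "e \<in> ?E" by blast
      have small_take: "\<forall>x\<in>set (take j v). ?Q x" "\<forall>x\<in>set (drop j v). ?Q x"
        using small[OF v] by (auto dest: in_set_takeD in_set_dropD)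
      have "\<not> ?Q e" using e by auto
      have "takeWhile ?Q (ins j e v) = take j v"
        using small_take \<open>\<not> ?Q e\<close> by (simp add: ins_def takeWhile_append2)
      moreover have "length (take j v) = j" using words_length[OF v] j by simp
      moreover have "filter ?Q (ins j e v) = v"
        using small_take \<open>\<not> ?Q e\<close> by (simp add: ins_def)
      ultimately show "?g (?f p) = p"
        by (simp add: p Let_def ins_def nth_append)
    qed
    show "\<forall>w\<in>words (Suc m). ?f (?g w) = w"
    proof
      fix w assume "w \<in> words (Suc m)"
      then obtain us e vs where "w = us @ e # vs" "\<bar>e\<bar> = ?N" "\<forall>x\<in>set us. ?Q x" "\<forall>x\<in>set vs. ?Q x"
        using split by blast
      then show "?f (?g w) = w" by (simp add: Let_def ins_def takeWhile_append2)
    qed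
    show "?f ` ?A \<subseteq> words (Suc m)"
    proof (rule image_subsetI)
      fix p assume "p \<in> ?A"
      then obtain v j e where p: "p = (v, j, e)" and v: "v \<in> words m" and j: "j \<in> {..m}"
        and e: "e \<in> ?E" by blast
      have ins_set: "set (ins j e v) = insert e (set v)"
        by (metis Un_insert_right append_take_drop_id ins_def list.simps(15) set_append)
      have "mset (ins j e v) = add_mset e (mset v)"
        unfolding ins_def by (simp, metis append_take_drop_id mset_append)
      then have "mset (map abs (ins j e v)) = mset (map abs (e # v))" by simp
      then have "distinct (map abs (ins j e v)) = distinct (map abs (e # v))"
        by (rule mset_eq_imp_distinct_iff)
      moreover have "distinct (map abs (e # v))" using v e small[OF v] by (auto simp: words_def)
      moreover have "abs ` set (ins j e v) = {1..int (Suc m)}"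
        using v e unfolding ins_set by (auto simp: words_def)
      ultimately show "?f p \<in> words (Suc m)" by (simp add: p words_def)
    qed
    show "?g ` words (Suc m) \<subseteq> ?A"
    proof (rule image_subsetI)
      fix w assume w: "w \<in> words (Suc m)"
      then obtain us e vs where w_eq: "w = us @ e # vs" and e: "\<bar>e\<bar> = ?N"
        and Q: "\<forall>x\<in>set us. ?Q x" "\<forall>x\<in>set vs. ?Q x"
        using split by blast
      have "abs ` set (us @ vs) = abs ` set w - {?N}" using Q e by (auto simp: w_eq)
      also have "\<dots> = {1..int m}" using w by (auto simp: words_def)
      finally have "us @ vs \<in> words m" using w by (auto simp: words_def w_eq)
      moreover from this have "length us \<le> m" using words_length[of "us @ vs" m] by simp
      moreover have "?g w = (us @ vs, length us, e)"
        using Q e by (simp add: w_eq Let_def takeWhile_append2)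
      moreover have "e \<in> ?E" using e by auto
      ultimately show "?g w \<in> ?A" by simp
    qed
  qed
  then have "(\<Sum>w\<in>words (Suc m). F w) = (\<Sum>p\<in>?A. F (?f p))"
    by (rule sum.reindex_bij_betw[symmetric])
  also have "\<dots> = (\<Sum>v\<in>words m. \<Sum>p\<in>{..m} \<times> ?E. F (?f (v, p)))"
    by (subst sum.cartesian_product) (auto intro: sum.cong)
  also have "\<dots> = (\<Sum>v\<in>words m. \<Sum>j\<le>m. \<Sum>e\<in>?E. F (ins j e v))"
    by (simp add: sum.cartesian_product')
  finally show ?thesis by simp
qed

text \<open>Induction on the part after \<open>y\<close>. Directly after \<open>y\<close> both signs create exactly one descent
  in place of the comparison of \<open>y\<close> with \<open>z\<close>; every later insertion leaves that comparison alone,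
  which shifts the argument of \<open>g\<close> by a constant. For this reason \<open>g\<close> is arbitrary.\<close>

lemma sum_des_ins:
  assumes "\<forall>x\<in>set (y # zs). \<bar>x\<bar> < N"
  shows "(\<Sum>j\<le>length zs. g (des (y # ins j N zs)) + g (des (y # ins j (- N) zs)) :: int)
    = (2 * des (y # zs) + 1) * g (des (y # zs))
      + (2 * (int (length zs) - des (y # zs)) + 1) * g (des (y # zs) + 1)"
  using assms
proof (induction zs arbitrary: y g)
  case Nil
  then show ?case by (simp add: abs_less_iff)
next
  case (Cons z zs)
  let ?c = "of_bool (y > z) :: int" and ?d = "des (z # zs)"
  have "(\<Sum>j\<le>length (z # zs). g (des (y # ins j N (z # zs))) + g (des (y # ins j (- N) (z # zs))))
     = g (des (y # N # z # zs)) + g (des (y # (- N) # z # zs))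
       + (\<Sum>j\<le>length zs. g (?c + des (z # ins j N zs)) + g (?c + des (z # ins j (- N) zs)))"
    by (simp add: sum.atMost_Suc_shift del: sum.atMost_Suc)
  also have "(\<Sum>j\<le>length zs. g (?c + des (z # ins j N zs)) + g (?c + des (z # ins j (- N) zs)))
     = (2 * ?d + 1) * g (?c + ?d) + (2 * (int (length zs) - ?d) + 1) * g (?c + (?d + 1))"
    using Cons.IH[of z "\<lambda>d. g (?c + d)"] Cons.prems by simp
  also have "g (des (y # N # z # zs)) + g (des (y # (- N) # z # zs)) = g (?d + 1) + g (?d + 1)"
    using Cons.prems by (auto simp: abs_less_iff add.commute)
  also have "g (?d + 1) + g (?d + 1)
      + ((2 * ?d + 1) * g (?c + ?d) + (2 * (int (length zs) - ?d) + 1) * g (?c + (?d + 1)))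
    = (2 * des (y # z # zs) + 1) * g (des (y # z # zs))
      + (2 * (int (length (z # zs)) - des (y # z # zs)) + 1) * g (des (y # z # zs) + 1)"
    by (cases "y > z") (simp_all add: algebra_simps)
  finally show ?case .
qed

text \<open>The total weight of all words obtained from a word with parameters \<open>a\<close>, \<open>b\<close>, \<open>d\<close> and length \<open>m\<close>.
  The first line collects the insertions after the second letter. The two terms of the second
  line insert \<open>m + 1\<close> and \<open>- (m + 1)\<close> between the first two letters, and those of the third line
  insert them in front, where the old descent at \<open>1\<close> is pushed to \<open>2\<close>.\<close>

definition transfer ::
  "nat \<Rightarrow> (bool \<Rightarrow> bool \<Rightarrow> int \<Rightarrow> int) \<Rightarrow> bool \<Rightarrow> bool \<Rightarrow> int \<Rightarrow> int" where
  "transfer m G a b d = (2 * d + 1) * G a b d + (2 * (int m - 2 - d) + 1) * G a b (d + 1)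
      + G False False (d + 1) + G True True d
      + G False True (of_bool b + d) + G True False (of_bool b + d)"

lemma sum_stat_ins:
  assumes small: "\<forall>x\<in>set (x # y # zs). \<bar>x\<bar> < N" and m: "m = length (x # y # zs)"
  shows "(\<Sum>j\<le>m. stat G (ins j N (x # y # zs)) + stat G (ins j (- N) (x # y # zs)))
    = stat (transfer m G) (x # y # zs)"
proof -
  define a b d where "a = (x + y < 0)" and "b = (x > y)" and "d = des (y # zs)"
  note abd = this
  have "(\<Sum>j\<le>m. stat G (ins j N (x # y # zs)) + stat G (ins j (- N) (x # y # zs)))
    = stat G (N # x # y # zs) + stat G ((- N) # x # y # zs)
      + (stat G (x # N # y # zs) + stat G (x # (- N) # y # zs))
      + (\<Sum>j\<le>length zs. stat G (x # y # ins j N zs) + stat G (x # y # ins j (- N) zs))"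
    unfolding m by (simp add: sum.atMost_Suc_shift del: sum.atMost_Suc stat.simps)
  also have "(\<Sum>j\<le>length zs. stat G (x # y # ins j N zs) + stat G (x # y # ins j (- N) zs))
     = (2 * d + 1) * G a b d + (2 * (int (length zs) - d) + 1) * G a b (d + 1)"
    using sum_des_ins[of y zs N "G a b"] small by (simp add: abd)
  finally show ?thesis
    using small by (auto simp: m abd transfer_def abs_less_iff add.commute)
qed

lemma weighted_count_Suc:
  assumes "m \<ge> 2"
  shows "weighted_count G (Suc m) = weighted_count (transfer m G) m"
  unfolding weighted_count_def sum_words_Suc
proof (rule sum.cong[OF refl])
  fix v assume v: "v \<in> words m"
  then have len: "m = length v" by (simp add: words_length)
  then obtain x y zs where "v = x # y # zs"
    using assms by (metis Suc_le_length_iff numeral_2_eq_2)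
  moreover have "\<forall>x\<in>set v. \<bar>x\<bar> < int m + 1" using words_abs_le[OF v] by fastforce
  ultimately show "(\<Sum>j\<le>m. stat G (ins j (int m + 1) v) + stat G (ins j (- int m - 1) v))
      = stat (transfer m G) v"
    using sum_stat_ins[of x y zs "int m + 1" m G] len by (simp del: sum.atMost_Suc stat.simps)
qed

section \<open>The recurrences\<close>

lemma weighted_count_add:
  "weighted_count G n + weighted_count H n = weighted_count (\<lambda>a b d. G a b d + H a b d) n"
proof -
  have "stat G w + stat H w = stat (\<lambda>a b d. G a b d + H a b d) w" for w
    by (cases "(G, w)" rule: stat.cases) auto
  then show ?thesis by (simp add: weighted_count_def flip: sum.distrib)
qed

lemma weighted_count_scale: "c * weighted_count G n = weighted_count (\<lambda>a b d. c * G a b d) n"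
proof -
  have "c * stat G w = stat (\<lambda>a b d. c * G a b d) w" for w
    by (cases "(G, w)" rule: stat.cases) auto
  then show ?thesis by (simp add: weighted_count_def sum_distrib_left)
qed

lemma double_sub_Eulerian_numbers:
  assumes "n \<ge> 2"
  shows "2 * D1 n k = weighted_count (in_class False True k) n"
    and "2 * D01 n k = weighted_count (in_class True True k) n"
    and "2 * Dge2 n k = weighted_count (in_class False False k) n"
    and "2 * D0ge2 n k = weighted_count (in_class True False k) n"
  using double_sub_Eulerian[OF assms, of k False True] double_sub_Eulerian[OF assms, of k True True]
    double_sub_Eulerian[OF assms, of k False False] double_sub_Eulerian[OF assms, of k True False]
  by (simp_all add: D1_def D01_def Dge2_def D0ge2_def)

text \<open>The combinatorics is over: as functions of \<open>a\<close>, \<open>b\<close> and \<open>d\<close>, both sides are supported on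
  \<open>k - d \<in> {0, 1, 2, 3}\<close>, because every indicator involved fixes \<open>k - d\<close>, given \<open>a\<close> and \<open>b\<close>. On that
  support the coefficients \<open>2 d + 1\<close> and \<open>2 (m - 2 - d) + 1\<close> become functions of \<open>k\<close>. The terms
  with coefficient one record how the words of the other classes enter the given class. The class itself
  is entered from its own words through exactly one insertion at the first two places, which turns
  one of the two odd coefficients into an even one.\<close>

lemma transfer_in_class:
  fixes m :: nat
  defines "n \<equiv> int m + 1"
  shows "transfer m (in_class False True k) a b d =
      (2 * k - 1) * in_class False True k a b d + 2 * (n - k) * in_class False True (k - 1) a b d
      + in_class True True k a b d + in_class False False (k - 1) a b d + in_class True False k a b d"
      (is ?P1)
    and "transfer m (in_class True True k) a b d =
      2 * (k - 1) * in_class True True k a b d + (2 * n - 2 * k + 1) * in_class True True (k - 1) a b d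
      + in_class False True (k - 1) a b d + in_class False False (k - 2) a b d
      + in_class True False (k - 1) a b d"
      (is ?P2)
    and "transfer m (in_class False False k) a b d =
      (2 * k + 1) * in_class False False k a b d + 2 * (n - k - 1) * in_class False False (k - 1) a b d
      + in_class False True k a b d + in_class True True (k + 1) a b d + in_class True False k a b d"
      (is ?P3)
    and "transfer m (in_class True False k) a b d =
      2 * k * in_class True False k a b d + (2 * n - 2 * k - 1) * in_class True False (k - 1) a b d
      + in_class False True (k - 1) a b d + in_class True True k a b d
      + in_class False False (k - 1) a b d"
      (is ?P4)
proof -
  obtain c where k: "k = d + c" using that[of "k - d"] by simp
  have "c = 0 \<or> c = 1 \<or> c = 2 \<or> c = 3 \<or> c \<notin> {0, 1, 2, 3}" by blast
  then show ?P1 ?P2 ?P3 ?P4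
    unfolding transfer_def in_class_def n_def k
    by (cases a; cases b; elim disjE; simp)+
qed

lemma weighted_count_in_class_Suc:
  fixes m :: nat
  assumes "m \<ge> 2"
  defines "n \<equiv> int m + 1"
  defines "W \<equiv> \<lambda>a b k. weighted_count (in_class a b k) m"
  shows "weighted_count (in_class False True k) (Suc m) =
      (2 * k - 1) * W False True k + 2 * (n - k) * W False True (k - 1)
      + W True True k + W False False (k - 1) + W True False k"
    and "weighted_count (in_class True True k) (Suc m) =
      2 * (k - 1) * W True True k + (2 * n - 2 * k + 1) * W True True (k - 1)
      + W False True (k - 1) + W False False (k - 2) + W True False (k - 1)"
    and "weighted_count (in_class False False k) (Suc m) =
      (2 * k + 1) * W False False k + 2 * (n - k - 1) * W False False (k - 1)
      + W False True k + W True True (k + 1) + W True False k"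
    and "weighted_count (in_class True False k) (Suc m) =
      2 * k * W True False k + (2 * n - 2 * k - 1) * W True False (k - 1)
      + W False True (k - 1) + W True True k + W False False (k - 1)"
  unfolding weighted_count_Suc[OF assms(1)] W_def n_def
    transfer_in_class[abs_def] weighted_count_scale weighted_count_add
  by (rule refl)+

theorem proposition3p2:
  fixes n :: nat and k :: int
  assumes "n \<ge> 3" and "k \<ge> 0"
  shows "D1 n k = (2 * k - 1) * D1 (n - 1) k + 2 * (int n - k) * D1 (n - 1) (k - 1)
           + D01 (n - 1) k + Dge2 (n - 1) (k - 1) + D0ge2 (n - 1) k
    \<and> D01 n k = 2 * (k - 1) * D01 (n - 1) k + (2 * int n - 2 * k + 1) * D01 (n - 1) (k - 1)
           + D1 (n - 1) (k - 1) + Dge2 (n - 1) (k - 2) + D0ge2 (n - 1) (k - 1)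
    \<and> Dge2 n k = (2 * k + 1) * Dge2 (n - 1) k + 2 * (int n - k - 1) * Dge2 (n - 1) (k - 1)
           + D1 (n - 1) k + D01 (n - 1) (k + 1) + D0ge2 (n - 1) k
    \<and> D0ge2 n k = 2 * k * D0ge2 (n - 1) k + (2 * int n - 2 * k - 1) * D0ge2 (n - 1) (k - 1)
           + D1 (n - 1) (k - 1) + D01 (n - 1) k + Dge2 (n - 1) (k - 1)"
proof -
  obtain m where n: "n = Suc m" and m: "m \<ge> 2" using assms(1) by (cases n) auto
  have "2 \<le> Suc m" using m by simp
  note counts = double_sub_Eulerian_numbers[OF this] double_sub_Eulerian_numbers[OF m]
  note doubled = weighted_count_in_class_Suc[OF m, of k, folded counts]
  show ?thesis
    unfolding n diff_Suc_1
    using doubled by (auto simp: algebra_simps)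
qed

end
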